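(* Let $a$ and $b$ be nonnegative real parameters with $a\neq b$, let $x\in[a,b]$, and let $k_1,k_2,n$ be nonnegative integers. Let $m_1$ and $m_2$ be integers. Then $$\mathbb{Y}_{k_{1}+k_{2}}^{n}(x;a,b,m_{1}+m_{2})=\frac{2^{k_{1}+k_{2}-n}\,k_{1}!\,k_{2}!}{(k_{1}+k_{2})!}\sum_{j=0}^{n}\binom{n}{j}\mathbb{Y}_{k_{1}}^{j}(x;a,b,m_{1})\,\mathbb{Y}_{k_{2}}^{n-j}(x;a,b,m_{2}).$$
   Context: Here $[a,b]=\{x\in\mathbb{R}: a\le x\le b\}$ (so $a<b$). For an integer $m$ and a nonnegative integer $k$, put $$f_{\mathbb{Y},k}(x,t;a,b,m)=\frac{t^{k}(x-a)^{k}e^{(b-x)t}}{(b-a)^{m}\,k!}\qquad(t\in\mathbb{C}),$$ and define $\mathbb{Y}_{k}^{n}(x;a,b,m)$, $n=0,1,2,\dots$, by $$f_{\mathbb{Y},k}(x,t;a,b,m)=\sum_{n=0}^{\infty}\mathbb{Y}_{k}^{n}(x;a,b,m)\frac{t^{n}}{n!}.$$ In particular $\mathbb{Y}_k^n(x;a,b,m)=0$ when $n<k$. Convention: $0^0=1$. *)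

theory Defs
  imports "HOL-Analysis.Analysis"
begin

text \<open>
  The exponent \<open>m\<close> may be negative, hence \<open>powi\<close>. The convention \<open>0 ^ 0 = 1\<close>, relevant at
  \<open>x = a\<close> or \<open>t = 0\<close> with \<open>k = 0\<close>, is the one of the library.
\<close>

definition fY :: "nat \<Rightarrow> real \<Rightarrow> complex \<Rightarrow> real \<Rightarrow> real \<Rightarrow> int \<Rightarrow> complex" where
  "fY k x t a b m =
     t ^ k * of_real (x - a) ^ k * exp (of_real (b - x) * t)
       / (of_real (b - a) powi m * fact k)"

text \<open>
  \<open>Y k n x a b m\<close> is the number with upper index \<open>n\<close> and lower index \<open>k\<close>, as the coefficient of
  \<open>t ^ n / n!\<close> in the power series of the generating function, valid for every complex \<open>t\<close>.
  The lemma \<open>Y_ex1\<close> below shows that the description is well defined.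
\<close>

definition Y :: "nat \<Rightarrow> nat \<Rightarrow> real \<Rightarrow> real \<Rightarrow> real \<Rightarrow> int \<Rightarrow> complex" where
  "Y k n x a b m =
     (THE c :: nat \<Rightarrow> complex. \<forall>t. (\<lambda>i. c i * t ^ i / fact i) sums fY k x t a b m) n"

lemma powser_everywhere_unique:
  fixes c d :: "nat \<Rightarrow> complex"
  assumes c: "\<And>t. (\<lambda>i. c i * t ^ i / fact i) sums f t"
    and d: "\<And>t. (\<lambda>i. d i * t ^ i / fact i) sums f t"
  shows "c = d"
proof -
  define C where "C = Abs_fps (\<lambda>i. c i / fact i)"
  define D where "D = Abs_fps (\<lambda>i. d i / fact i)"
  have sC: "(\<lambda>i. fps_nth C i * t ^ i) sums f t" for t
    using c[of t] by (simp add: C_def)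
  have sD: "(\<lambda>i. fps_nth D i * t ^ i) sums f t" for t
    using d[of t] by (simp add: D_def)
  have rad: "0 < fps_conv_radius F" if "\<And>t. (\<lambda>i. fps_nth F i * t ^ i) sums f t" for F
  proof -
    have "norm (1 :: complex) \<le> conv_radius (fps_nth F)"
      using that[of 1] by (intro conv_radius_geI) (auto simp: sums_iff)
    moreover have "(0 :: ereal) < norm (1 :: complex)"
      by simp
    ultimately show ?thesis
      unfolding fps_conv_radius_def by (rule less_le_trans[rotated])
  qed
  have "eval_fps C t = eval_fps D t" for t
    using sC[of t] sD[of t] by (simp add: eval_fps_def sums_iff)
  then have "C = D"
    using rad[of C] rad[of D] sC sD by (intro eval_fps_eqD) auto
  then have "fps_nth C i = fps_nth D i" for i
    by simp
  then show ?thesis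
    by (simp add: C_def D_def fun_eq_iff)
qed

lemma Y_ex1: "\<exists>!c :: nat \<Rightarrow> complex. \<forall>t. (\<lambda>i. c i * t ^ i / fact i) sums fY k x t a b m"
proof (rule ex_ex1I)
  define A :: complex where "A = of_real (x - a) ^ k / (of_real (b - a) powi m * fact k)"
  define \<beta> :: complex where "\<beta> = of_real (b - x)"
  define c where "c i = (if i < k then 0 else A * \<beta> ^ (i - k) * fact i / fact (i - k))" for i
  have "(\<lambda>i. c i * t ^ i / fact i) sums fY k x t a b m" for t
  proof -
    have "(\<lambda>i. (A * t ^ k) * ((\<beta> * t) ^ i /\<^sub>R fact i)) sums ((A * t ^ k) * exp (\<beta> * t))"
      by (intro sums_mult exp_converges)
    also have "(\<lambda>i. (A * t ^ k) * ((\<beta> * t) ^ i /\<^sub>R fact i)) =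
        (\<lambda>i. c (i + k) * t ^ (i + k) / fact (i + k))"
      by (auto simp: c_def fun_eq_iff power_add power_mult_distrib scaleR_conv_of_real field_simps)
    also have "(A * t ^ k) * exp (\<beta> * t) = fY k x t a b m"
      by (simp add: fY_def A_def \<beta>_def)
    finally have "(\<lambda>i. c (i + k) * t ^ (i + k) / fact (i + k)) sums fY k x t a b m" .
    moreover have "(\<Sum>i<k. c i * t ^ i / fact i) = 0"
      by (simp add: c_def)
    ultimately show ?thesis
      using sums_iff_shift[of "\<lambda>i. c i * t ^ i / fact i" k "fY k x t a b m"] by simp
  qed
  then show "\<exists>c. \<forall>t. (\<lambda>i. c i * t ^ i / fact i) sums fY k x t a b m"
    by blast
next
  fix c d :: "nat \<Rightarrow> complex"
  assume "\<forall>t. (\<lambda>i. c i * t ^ i / fact i) sums fY k x t a b m"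
    and "\<forall>t. (\<lambda>i. d i * t ^ i / fact i) sums fY k x t a b m"
  then show "c = d"
    by (intro powser_everywhere_unique[of c "\<lambda>t. fY k x t a b m" d]) simp_all
qed

lemma Y_sums: "(\<lambda>n. Y k n x a b m * t ^ n / fact n) sums fY k x t a b m"
  using theI'[OF Y_ex1[of k x a b m]] unfolding Y_def by blast

end

theory Submission
  imports Defs
begin

text \<open>
  Apart from the factorial, the factors of \<open>fY\<close> that involve \<open>k\<close> or \<open>m\<close> are powers with these
  exponents, and \<open>exp ((b - x) t)\<close> involves neither. In a product of two generating functions
  at \<open>t\<close> the exponents add up to \<open>k1 + k2\<close> and \<open>m1 + m2\<close>, while the exponential is squared, so
  that it belongs to the argument \<open>2 t\<close>. Passing from \<open>t\<close> to \<open>2 t\<close> in \<open>t ^ (k1 + k2)\<close> gives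
  the factor \<open>2 ^ (k1 + k2)\<close>, and the factorials in the denominators give the reciprocal of a
  binomial coefficient. This is \<open>fY_add\<close>, written with \<open>t / 2\<close> on the right-hand side.

  The Taylor coefficients of a product are binomial convolutions (\<open>sums_binomial_convolution\<close>),
  and halving the argument divides the coefficient of order \<open>n\<close> by \<open>2 ^ n\<close>. Comparing
  coefficients proves the theorem.
\<close>

text \<open>
  Convergence for all arguments makes both series absolutely convergent, so their Cauchy product
  converges to the product of the limits.
\<close>

lemma sums_binomial_convolution:
  fixes c d :: "nat \<Rightarrow> complex"
  assumes c: "\<And>t. (\<lambda>i. c i * t ^ i / fact i) sums f t"
    and d: "\<And>t. (\<lambda>i. d i * t ^ i / fact i) sums g t"
  shows "(\<lambda>i. (\<Sum>j = 0..i. of_nat (i choose j) * c j * d (i - j)) * t ^ i / fact i)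
    sums (f t * g t)"
proof -
  have abs_summable: "summable (\<lambda>i. norm (e i * t ^ i / fact i))"
    if e: "\<And>t. (\<lambda>i. e i * t ^ i / fact i) sums h t" for e :: "nat \<Rightarrow> complex" and h
  proof -
    define z :: complex where "z = of_real (norm t + 1)"
    have "summable (\<lambda>i. e i / fact i * z ^ i)"
      using e[of z] by (simp add: sums_iff)
    moreover have "norm t < norm z"
      unfolding z_def norm_of_real by simp
    ultimately have "summable (\<lambda>i. norm (e i / fact i * t ^ i))"
      by (rule powser_insidea)
    then show ?thesis
      by simp
  qed
  have "(\<lambda>i. \<Sum>j\<le>i. (c j * t ^ j / fact j) * (d (i - j) * t ^ (i - j) / fact (i - j)))
    sums (f t * g t)"
    using Cauchy_product_sums[OF abs_summable[OF c] abs_summable[OF d]] c[of t] d[of t]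
    by (simp add: sums_iff)
  moreover have "(\<Sum>j\<le>i. (c j * t ^ j / fact j) * (d (i - j) * t ^ (i - j) / fact (i - j))) =
    (\<Sum>j = 0..i. of_nat (i choose j) * c j * d (i - j)) * t ^ i / fact i" for i
    unfolding atMost_atLeast0 sum_distrib_right sum_divide_distrib
  proof (rule sum.cong[OF refl])
    fix j assume "j \<in> {0..i}"
    then have "j \<le> i" by simp
    then have "t ^ i = t ^ j * t ^ (i - j)"
      by (simp flip: power_add)
    with \<open>j \<le> i\<close> show "(c j * t ^ j / fact j) * (d (i - j) * t ^ (i - j) / fact (i - j)) =
        of_nat (i choose j) * c j * d (i - j) * t ^ i / fact i"
      by (simp add: binomial_fact)
  qed
  ultimately show ?thesis
    by simp
qed

lemma fY_add:
  assumes "a \<noteq> b"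
  shows "fY (k1 + k2) x t a b (m1 + m2) =
    2 ^ (k1 + k2) * fact k1 * fact k2 / fact (k1 + k2) *
      (fY k1 x (t / 2) a b m1 * fY k2 x (t / 2) a b m2)"
proof -
  have "complex_of_real (b - a) \<noteq> 0"
    using assms by simp
  then have "complex_of_real (b - a) powi (m1 + m2) =
      of_real (b - a) powi m1 * of_real (b - a) powi m2"
    by (simp add: power_int_add)
  moreover have "exp (complex_of_real (b - x) * t) =
      exp (of_real (b - x) * (t / 2)) * exp (of_real (b - x) * (t / 2))"
    by (simp add: algebra_simps flip: exp_add)
  ultimately show ?thesis
    by (simp add: fY_def power_add power_divide mult_ac del: of_real_diff)
qed

lemma Y_eqI:
  assumes "\<And>t. (\<lambda>i. c i * t ^ i / fact i) sums fY k x t a b m"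
  shows "Y k n x a b m = c n"
  using powser_everywhere_unique[OF Y_sums assms] by (rule fun_cong)

theorem theorem2:
  fixes a b x :: real and k1 k2 n :: nat and m1 m2 :: int
  assumes "0 \<le> a" and "0 \<le> b" and "a \<noteq> b" and "x \<in> {a..b}"
  shows "Y (k1 + k2) n x a b (m1 + m2) =
    2 powi (int k1 + int k2 - int n) * fact k1 * fact k2 / fact (k1 + k2) *
      (\<Sum>j = 0..n. of_nat (n choose j) * Y k1 j x a b m1 * Y k2 (n - j) x a b m2)"
proof (rule Y_eqI)
  fix t
  define S where
    "S i = (\<Sum>j = 0..i. of_nat (i choose j) * Y k1 j x a b m1 * Y k2 (i - j) x a b m2)" for i
  define C :: complex where "C = 2 ^ (k1 + k2) * fact k1 * fact k2 / fact (k1 + k2)"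
  have "(\<lambda>i. S i * (t / 2) ^ i / fact i) sums (fY k1 x (t / 2) a b m1 * fY k2 x (t / 2) a b m2)"
    unfolding S_def by (rule sums_binomial_convolution[OF Y_sums Y_sums])
  then have "(\<lambda>i. C * (S i * (t / 2) ^ i / fact i))
      sums fY (k1 + k2) x t a b (m1 + m2)"
    unfolding fY_add[OF \<open>a \<noteq> b\<close>] C_def by (rule sums_mult)
  moreover have "C * (S i * (t / 2) ^ i / fact i) =
      2 powi (int k1 + int k2 - int i) * fact k1 * fact k2 / fact (k1 + k2) * S i * t ^ i / fact i"
    for i
  proof -
    have "(2 :: complex) powi (int k1 + int k2 - int i) = 2 ^ (k1 + k2) / 2 ^ i"
      by (simp add: power_int_diff power_int_add power_add)
    then show ?thesis
      by (simp add: C_def power_divide mult_ac)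
  qed
  ultimately show "(\<lambda>i. 2 powi (int k1 + int k2 - int i) * fact k1 * fact k2 / fact (k1 + k2) *
      (\<Sum>j = 0..i. of_nat (i choose j) * Y k1 j x a b m1 * Y k2 (i - j) x a b m2) * t ^ i / fact i)
      sums fY (k1 + k2) x t a b (m1 + m2)"
    by (simp add: S_def)
qed

end
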